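(* Let $P$ be an irreducible, semi-isotropic transition matrix on $\mathrm{DL}(q,r)$, with projections $P_1$ on $\mathbb T^1$ and $P_2$ on $\mathbb T^2$. (a) Every minimal $P$-harmonic function $h$ on $\mathrm{DL}(q,r)$ is of the form $h(x_1x_2)=h_1(x_1)$ or $h(x_1x_2)=h_2(x_2)$, where $h_i$ is a minimal $P_i$-harmonic function on $\mathbb T^i$ ($i=1$ resp. $i=2$). (b) If $h$ is a positive $P$-harmonic function on $\mathrm{DL}(q,r)$, then there are non-negative $P_i$-harmonic functions $h_i$ on $\mathbb T^i$ ($i=1,2$) such that $h(x_1x_2)=h_1(x_1)+h_2(x_2)$ for all $x_1x_2\in\mathrm{DL}(q,r)$.
   Context: Tree notation: for $s\ge 2$, $\mathbb T_s$ is the homogeneous tree of degree $s+1$ with graph metric $d$. Fix an end $\omega$ and a root $o$. Each vertex $x$ has a unique neighbour $x^-$ (its predecessor) on the geodesic ray from $x$ to $\omega$. $\mathrm{hor}:\mathbb T_s\to\mathbb Z$ is defined by $\mathrm{hor}(o)=0$, $\mathrm{hor}(x)=\mathrm{hor}(x^-)+1$. The ancestors of $x$ are $x,x^-,(x^-)^-,\dots$; $x\curlywedge y$ is the common ancestor of $x,y$ with maximal $\mathrm{hor}$, and $\mathrm{up}(x,y)=\mathrm{hor}(x)-\mathrm{hor}(x\curlywedge y)$. DL-graphs: $\mathbb T^1=\mathbb T_q$, $\mathbb T^2=\mathbb T_r$ ($q,r\ge2$) with their own $\omega_i,o_i,\mathrm{hor},\mathrm{up}$. $\mathrm{DL}(q,r)=\{x_1x_2: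 x_i\in\mathbb T^i,\ \mathrm{hor}(x_1)+\mathrm{hor}(x_2)=0\}$, $x_1x_2\sim y_1y_2$ iff $x_1\sim y_1$ and $x_2\sim y_2$; root $o=o_1o_2$. $P$ is semi-isotropic if $p(x,y)=\mathfrak m\big(\mathrm{up}(x_1,y_1),\mathrm{up}(y_1,x_1),\mathrm{up}(x_2,y_2),\mathrm{up}(y_2,x_2)\big)$ for a probability measure $\mathfrak m$ on $\{(k_1,l_1,k_2,l_2)\in\mathbb N_0^4: k_1+k_2=l_1+l_2\}$. Projection: $p_1(x_1,y_1)=\sum_{y_2:\,y_1y_2\in\mathrm{DL}}p(x_1x_2,y_1y_2)$, independent of $x_2$; $P_2$ analogously. Harmonic: $h=Ph$. A positive harmonic function $h$ (on a state space with root $o$) is minimal if $h(o)=1$ and for every positive harmonic $h'$ with $h'\le h$ the ratio $h'/h$ is constant. *)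

theory Defs
  imports "HOL-Analysis.Analysis"
begin

text \<open>A vertex is a pair (n, a): n = hor(x) is the horocycle index and a j (for j \<le> n)
  is the label in {0..s-1} of the ancestor of x at level j among the s children of its
  predecessor. Labels vanish above level n and far below (the ancestors of the root o
  all carry label 0), so the ancestor chain of x merges with that of o.
  Each vertex has exactly one predecessor and s successors: degree s+1.\<close>

type_synonym tv = "int \<times> (int \<Rightarrow> nat)"

definition tree :: "nat \<Rightarrow> tv set" where
  "tree s = {(n, a). (\<forall>j. a j < s) \<and> (\<forall>j. j > n \<longrightarrow> a j = 0) \<and> (\<exists>m. \<forall>j. j < m \<longrightarrow> a j = 0)}"

definition troot :: tv where
  "troot = (0, \<lambda>_. 0)"

definition hor :: "tv \<Rightarrow> int" where
  "hor x = fst x"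

text \<open>The predecessor x^- (neighbour of x on the ray towards omega).\<close>
definition pred :: "tv \<Rightarrow> tv" where
  "pred x = (fst x - 1, (snd x)(fst x := 0))"

definition tree_adj :: "nat \<Rightarrow> tv \<Rightarrow> tv \<Rightarrow> bool" where
  "tree_adj s x y \<longleftrightarrow> x \<in> tree s \<and> y \<in> tree s \<and> (y = pred x \<or> x = pred y)"

definition ancestors :: "tv \<Rightarrow> tv set" where
  "ancestors x = {(pred ^^ k) x | k. True}"

definition confl :: "tv \<Rightarrow> tv \<Rightarrow> tv" where
  "confl x y = (ARG_MAX hor z. z \<in> ancestors x \<and> z \<in> ancestors y)"

definition up :: "tv \<Rightarrow> tv \<Rightarrow> nat" where
  "up x y = nat (hor x - hor (confl x y))"

type_synonym dlv = "tv \<times> tv"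

definition DL :: "nat \<Rightarrow> nat \<Rightarrow> dlv set" where
  "DL q r = {(x1, x2). x1 \<in> tree q \<and> x2 \<in> tree r \<and> hor x1 + hor x2 = 0}"

definition DL_adj :: "nat \<Rightarrow> nat \<Rightarrow> dlv \<Rightarrow> dlv \<Rightarrow> bool" where
  "DL_adj q r x y \<longleftrightarrow> x \<in> DL q r \<and> y \<in> DL q r \<and> tree_adj q (fst x) (fst y) \<and> tree_adj r (snd x) (snd y)"

definition DL_root :: dlv where
  "DL_root = (troot, troot)"

definition stochastic :: "'a set \<Rightarrow> ('a \<Rightarrow> 'a \<Rightarrow> real) \<Rightarrow> bool" where
  "stochastic V p \<longleftrightarrow> (\<forall>x\<in>V. (\<forall>y\<in>V. p x y \<ge> 0) \<and> (p x has_sum 1) V)"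

definition irreducible :: "'a set \<Rightarrow> ('a \<Rightarrow> 'a \<Rightarrow> real) \<Rightarrow> bool" where
  "irreducible V p \<longleftrightarrow>
     (\<forall>x\<in>V. \<forall>y\<in>V. (\<lambda>u v. u \<in> V \<and> v \<in> V \<and> p u v > 0)\<^sup>*\<^sup>* x y)"

definition semi_isotropic :: "nat \<Rightarrow> nat \<Rightarrow> (dlv \<Rightarrow> dlv \<Rightarrow> real) \<Rightarrow> bool" where
  "semi_isotropic q r p \<longleftrightarrow>
     (\<exists>m :: nat \<times> nat \<times> nat \<times> nat \<Rightarrow> real. \<forall>x\<in>DL q r. \<forall>y\<in>DL q r.
        p x y = m (up (fst x) (fst y), up (fst y) (fst x), up (snd x) (snd y), up (snd y) (snd x)))"

text \<open>Projections (independent of the choice of the second/first coordinate of x).\<close>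
definition proj1 :: "nat \<Rightarrow> nat \<Rightarrow> (dlv \<Rightarrow> dlv \<Rightarrow> real) \<Rightarrow> tv \<Rightarrow> tv \<Rightarrow> real" where
  "proj1 q r p x1 y1 =
     infsum (\<lambda>y2. p (x1, SOME x2. (x1, x2) \<in> DL q r) (y1, y2)) {y2. (y1, y2) \<in> DL q r}"

definition proj2 :: "nat \<Rightarrow> nat \<Rightarrow> (dlv \<Rightarrow> dlv \<Rightarrow> real) \<Rightarrow> tv \<Rightarrow> tv \<Rightarrow> real" where
  "proj2 q r p x2 y2 =
     infsum (\<lambda>y1. p (SOME x1. (x1, x2) \<in> DL q r, x2) (y1, y2)) {y1. (y1, y2) \<in> DL q r}"

definition harmonic :: "'a set \<Rightarrow> ('a \<Rightarrow> 'a \<Rightarrow> real) \<Rightarrow> ('a \<Rightarrow> real) \<Rightarrow> bool" where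
  "harmonic V p h \<longleftrightarrow> (\<forall>x\<in>V. ((\<lambda>y. p x y * h y) has_sum h x) V)"

definition pos_harmonic :: "'a set \<Rightarrow> ('a \<Rightarrow> 'a \<Rightarrow> real) \<Rightarrow> ('a \<Rightarrow> real) \<Rightarrow> bool" where
  "pos_harmonic V p h \<longleftrightarrow> harmonic V p h \<and> (\<forall>x\<in>V. h x > 0)"

definition minimal_harmonic :: "'a set \<Rightarrow> 'a \<Rightarrow> ('a \<Rightarrow> 'a \<Rightarrow> real) \<Rightarrow> ('a \<Rightarrow> real) \<Rightarrow> bool" where
  "minimal_harmonic V rt p h \<longleftrightarrow> pos_harmonic V p h \<and> h rt = 1 \<and>
     (\<forall>h'. pos_harmonic V p h' \<and> (\<forall>x\<in>V. h' x \<le> h x) \<longrightarrow> (\<exists>c. \<forall>x\<in>V. h' x = c * h x))"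

end

theory Submission
  imports Defs "HOL-Complex_Analysis.Great_Picard"
begin

text \<open>Let W N x y be the expected number of visits to y before time N of the walk started at x.
  A positive harmonic h equals the average (1/N) * (sum over y of W N x y * h y) for every N.
  By the maximum principle W N x y / N differs from W N y y / N by o(1), and since all points of an
  infinite horocycle have the same diagonal value, W N x y / N tends to 0: finite sets of y do not
  contribute in the limit. Split DL into two sets A and B such that, for every k, only finitely many
  y in A have their second coordinate below the k-th ancestor of the root, and only finitely many y in B
  have their first coordinate there. Since W is invariant under automorphisms, the contribution of A
  converges along a subsequence to a harmonic function that depends only on the first coordinate, and
  that of B to one that depends only on the second. The minimal case follows since one of the two
  summands is proportional to h.\<close>

subsection \<open>Averages of Green kernels\<close>

text \<open>Tonelli for non-negative double sums: summable rows with summable row sums give joint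
  summability, so the columns may be summed first. It exchanges the first step of the walk with the
  visited point in \<open>green_Suc_has_sum\<close>.\<close>

lemma nonneg_has_sum_swap:
  fixes f :: "'a \<Rightarrow> 'b \<Rightarrow> real"
  assumes nonneg: "\<And>x y. x \<in> A \<Longrightarrow> y \<in> B \<Longrightarrow> f x y \<ge> 0"
    and f: "\<And>x. x \<in> A \<Longrightarrow> (f x has_sum g x) B"
    and g: "(g has_sum s) A"
  shows "((\<lambda>y. infsum (\<lambda>x. f x y) A) has_sum s) B"
proof -
  have summable: "(\<lambda>(x, y). f x y) summable_on A \<times> B"
    using f g nonneg by (intro summable_on_SigmaI[where g = g]) (auto simp: summable_on_def)
  have "((\<lambda>(x, y). f x y) has_sum s) (A \<times> B)"
    using f g summable by (intro has_sum_SigmaI[where g = g]) auto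
  hence swapped: "((\<lambda>(y, x). f x y) has_sum s) (B \<times> A)"
    by (subst (asm) has_sum_swap) (simp add: case_prod_unfold)
  hence "(\<lambda>x. f x y) summable_on A" if "y \<in> B" for y
    using summable_on_SigmaD1[of "\<lambda>y x. f x y" B "\<lambda>_. A" y] that
    by (auto simp: summable_on_def)
  thus ?thesis
    by (intro has_sum_SigmaD[OF swapped]) auto
qed

text \<open>Expected number of visits to y at the times 0, ..., n - 1.\<close>

primrec green :: "'a set \<Rightarrow> ('a \<Rightarrow> 'a \<Rightarrow> real) \<Rightarrow> nat \<Rightarrow> 'a \<Rightarrow> 'a \<Rightarrow> real" where
  "green V p 0 x y = 0"
| "green V p (Suc n) x y = of_bool (x = y) + infsum (\<lambda>z. p x z * green V p n z y) V"

definition chain_automorphism :: "'a set \<Rightarrow> ('a \<Rightarrow> 'a \<Rightarrow> real) \<Rightarrow> ('a \<Rightarrow> 'a) \<Rightarrow> bool" where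
  "chain_automorphism V p \<phi> \<longleftrightarrow>
     bij_betw \<phi> V V \<and> (\<forall>x\<in>V. \<forall>y\<in>V. p (\<phi> x) (\<phi> y) = p x y)"

locale markov_chain =
  fixes V :: "'a set" and p :: "'a \<Rightarrow> 'a \<Rightarrow> real"
  assumes stochastic: "stochastic V p"
begin

lemma p_nonneg: "x \<in> V \<Longrightarrow> y \<in> V \<Longrightarrow> p x y \<ge> 0"
  using stochastic by (auto simp: stochastic_def)

lemma p_has_sum: "x \<in> V \<Longrightarrow> (p x has_sum 1) V"
  using stochastic by (auto simp: stochastic_def)

lemma harmonic_one: "harmonic V p (\<lambda>_. 1)"
  using p_has_sum by (simp add: harmonic_def)

lemma average_summable:
  assumes "x \<in> V" and "\<And>z. z \<in> V \<Longrightarrow> 0 \<le> f z \<and> f z \<le> c"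
  shows "(\<lambda>z. p x z * f z) summable_on V"
proof (rule summable_on_comparison_test)
  show "(\<lambda>z. p x z * c) summable_on V"
    using has_sum_cmult_left[OF p_has_sum[OF assms(1)]] by (auto simp: summable_on_def)
qed (use assms p_nonneg in \<open>auto intro: mult_left_mono\<close>)

lemma average_le:
  assumes "x \<in> V" and "\<And>z. z \<in> V \<Longrightarrow> 0 \<le> f z \<and> f z \<le> c"
  shows "infsum (\<lambda>z. p x z * f z) V \<le> c"
proof -
  have "infsum (\<lambda>z. p x z * f z) V \<le> infsum (\<lambda>z. p x z * c) V"
    using assms p_nonneg has_sum_cmult_left[OF p_has_sum[OF assms(1)], of c]
    by (intro infsum_mono average_summable[OF assms]) (auto intro: mult_left_mono simp: summable_on_def)
  also have "\<dots> = c"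
    using has_sum_cmult_left[OF p_has_sum[OF assms(1)], of c] by (simp add: infsumI)
  finally show ?thesis .
qed

lemma green_bounds: "x \<in> V \<Longrightarrow> y \<in> V \<Longrightarrow> 0 \<le> green V p n x y \<and> green V p n x y \<le> n"
proof (induction n arbitrary: x)
  case (Suc n)
  have "infsum (\<lambda>z. p x z * green V p n z y) V \<le> n"
    using Suc by (intro average_le) auto
  moreover have "infsum (\<lambda>z. p x z * green V p n z y) V \<ge> 0"
    using Suc p_nonneg by (intro infsum_nonneg) auto
  ultimately show ?case by (auto simp: of_bool_def)
qed auto

lemma green_summable:
  "x \<in> V \<Longrightarrow> y \<in> V \<Longrightarrow> (\<lambda>z. p x z * green V p n z y) summable_on V"
  using green_bounds by (intro average_summable[where c = n]) auto

lemma green_mono: "x \<in> V \<Longrightarrow> y \<in> V \<Longrightarrow> green V p n x y \<le> green V p (Suc n) x y"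
proof (induction n arbitrary: x)
  case (Suc n)
  have "infsum (\<lambda>z. p x z * green V p n z y) V \<le> infsum (\<lambda>z. p x z * green V p (Suc n) z y) V"
    using Suc p_nonneg by (intro infsum_mono green_summable mult_left_mono) auto
  thus ?case by simp
qed (use green_bounds[of x y "Suc 0" for x] in auto)

text \<open>Counting starts only when the walk reaches \<open>y\<close>, and then fewer steps
  remain. Instead of a hitting time, the induction averages: for \<open>x\<close> other than
  \<open>y\<close>, one step leads to values bounded by the diagonal value, which grows with
  \<open>n\<close>.\<close>

lemma green_le_diagonal: "x \<in> V \<Longrightarrow> y \<in> V \<Longrightarrow> green V p n x y \<le> green V p n y y"
proof (induction n arbitrary: x)
  case (Suc n)
  show ?case
  proof (cases "x = y")
    case False
    have "green V p (Suc n) x y = infsum (\<lambda>z. p x z * green V p n z y) V"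
      using False by simp
    also have "\<dots> \<le> green V p n y y"
      using Suc green_bounds by (intro average_le) auto
    also have "\<dots> \<le> green V p (Suc n) y y"
      using Suc.prems by (intro green_mono)
    finally show ?thesis .
  qed simp
qed auto

text \<open>The first-step recursion involves only \<open>p\<close> and a sum over \<open>V\<close>,
  and reindexing that sum by \<open>\<phi>\<close> leaves it unchanged.\<close>

lemma green_automorphism:
  assumes \<phi>: "chain_automorphism V p \<phi>"
  shows "x \<in> V \<Longrightarrow> y \<in> V \<Longrightarrow> green V p n (\<phi> x) (\<phi> y) = green V p n x y"
proof (induction n arbitrary: x)
  case (Suc n)
  have bij: "bij_betw \<phi> V V" and inv: "\<forall>z\<in>V. p (\<phi> x) (\<phi> z) = p x z"
    using \<phi> Suc.prems by (auto simp: chain_automorphism_def)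
  have "infsum (\<lambda>z. p (\<phi> x) z * green V p n z (\<phi> y)) V
      = infsum (\<lambda>z. p (\<phi> x) (\<phi> z) * green V p n (\<phi> z) (\<phi> y)) V"
    by (rule infsum_reindex_bij_betw[OF bij, symmetric])
  also have "\<dots> = infsum (\<lambda>z. p x z * green V p n z y) V"
    using Suc inv by (intro infsum_cong) auto
  finally show ?case
    using Suc.prems bij by (auto simp: bij_betw_def inj_on_eq_iff)
qed auto

text \<open>First-step decomposition of the expected total of \<open>f\<close> along the walk: its
  value at the start, plus the mean of the \<open>n\<close>-step totals after one step.\<close>

lemma green_Suc_has_sum:
  assumes x: "x \<in> V" and f: "\<And>y. y \<in> V \<Longrightarrow> f y \<ge> 0"
    and g: "\<And>z. z \<in> V \<Longrightarrow> ((\<lambda>y. green V p n z y * f y) has_sum g z) V"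
    and s: "((\<lambda>z. p x z * g z) has_sum s) V"
  shows "((\<lambda>y. green V p (Suc n) x y * f y) has_sum (f x + s)) V"
proof -
  have "((\<lambda>y. infsum (\<lambda>z. p x z * (green V p n z y * f y)) V) has_sum s) V"
    using g x f green_bounds p_nonneg
    by (intro nonneg_has_sum_swap[OF _ _ s] has_sum_cmult_right) auto
  moreover have "((\<lambda>y. of_bool (x = y) * f y) has_sum f x) V"
    using x by (intro has_sum_finite_neutralI[of "{x}"]) auto
  ultimately have "((\<lambda>y. of_bool (x = y) * f y + infsum (\<lambda>z. p x z * (green V p n z y * f y)) V)
      has_sum (f x + s)) V"
    by (intro has_sum_add)
  moreover have "infsum (\<lambda>z. p x z * (green V p n z y * f y)) V
      = infsum (\<lambda>z. p x z * green V p n z y) V * f y" for y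
    by (subst infsum_cmult_left'[symmetric]) (simp add: mult.assoc)
  ultimately show ?thesis
    by (simp add: distrib_right)
qed

text \<open>At each of the \<open>n\<close> times the expected value of \<open>h\<close> along the
  walk is still \<open>h x\<close>.\<close>

lemma green_harmonic:
  assumes h: "harmonic V p h" "\<And>x. x \<in> V \<Longrightarrow> h x \<ge> 0"
  shows "x \<in> V \<Longrightarrow> ((\<lambda>y. green V p n x y * h y) has_sum (n * h x)) V"
proof (induction n arbitrary: x)
  case (Suc n)
  have "((\<lambda>z. real n * (p x z * h z)) has_sum (n * h x)) V"
    using h(1) Suc.prems by (intro has_sum_cmult_right) (auto simp: harmonic_def)
  hence "((\<lambda>z. p x z * (n * h z)) has_sum (n * h x)) V"
    by (simp add: mult.left_commute)
  from green_Suc_has_sum[OF Suc.prems h(2) Suc.IH this]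
  show ?case by (simp add: algebra_simps)
qed simp

section \<open>Decay of the averaged visit counts\<close>

text \<open>All gaps to the diagonal value are non-negative, so a single summand is at most their
  \<open>p\<close>-average. That average is the gap at \<open>x\<close> up to the visit counted at
  time 0 and the passage from \<open>n\<close> to \<open>Suc n\<close>, which together cost at most
  1.\<close>

lemma green_diagonal_gap_step:
  assumes "x \<in> V" "y \<in> V" "z \<in> V"
  shows "p x z * (green V p n y y - green V p n z y)
    \<le> green V p n y y - green V p n x y + 1"
proof -
  let ?c = "green V p n y y"
  have "((\<lambda>z. p x z * ?c - p x z * green V p n z y) has_sum
      (1 * ?c - infsum (\<lambda>z. p x z * green V p n z y) V)) V"
    unfolding diff_conv_add_uminus using assms
    by (intro has_sum_add has_sum_uminusI has_sum_cmult_left p_has_sum has_sum_infsum green_summable)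
  hence "(\<Sum>z\<in>{z}. p x z * ?c - p x z * green V p n z y)
      \<le> 1 * ?c - infsum (\<lambda>z. p x z * green V p n z y) V"
    using assms green_le_diagonal p_nonneg
    by (intro finite_sum_le_has_sum[where A = V]) (auto intro: mult_left_mono)
  moreover have "green V p n x y \<le> green V p (Suc n) x y"
    using assms by (intro green_mono)
  ultimately show ?thesis
    by (auto simp: algebra_simps of_bool_def split: if_splits)
qed

text \<open>The gap is 0 at \<open>y\<close> itself. Along a path of positive transitions from
  \<open>y\<close> to \<open>x\<close>, each step costs a factor \<open>1 / p u v\<close> and an
  error \<open>1 / n\<close>, so convergence to 0 is inherited.\<close>

lemma green_diagonal_gap:
  assumes irr: "irreducible V p" and "x \<in> V" "y \<in> V"
  shows "(\<lambda>n. (green V p n y y - green V p n x y) / n) \<longlonglongrightarrow> 0"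
proof -
  have "(\<lambda>u v. u \<in> V \<and> v \<in> V \<and> p u v > 0)\<^sup>*\<^sup>* y x"
    using assms by (auto simp: irreducible_def)
  thus ?thesis
  proof induction
    case (step u v)
    let ?D = "\<lambda>x n. (green V p n y y - green V p n x y) / n"
    have "(\<lambda>n. (?D u n + 1 / n) / p u v) \<longlonglongrightarrow> (0 + 0) / p u v"
      using step by (intro tendsto_intros lim_1_over_n) auto
    hence lim: "(\<lambda>n. (?D u n + 1 / n) / p u v) \<longlonglongrightarrow> 0"
      by simp
    have upper: "?D v n \<le> (?D u n + 1 / n) / p u v" for n
    proof (cases "n = 0")
      case False
      have "p u v * (green V p n y y - green V p n v y) \<le> green V p n y y - green V p n u y + 1"
        using step assms by (intro green_diagonal_gap_step) auto
      hence "n * (p u v * (green V p n y y - green V p n v y)) \<le> n * (green V p n y y - green V p n u y + 1)"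
        by (intro mult_left_mono) auto
      thus ?thesis
        using False step by (simp add: field_simps)
    qed auto
    have lower: "0 \<le> ?D v n" for n
      using green_le_diagonal[of v y n] step assms by simp
    show ?case
      by (rule tendsto_sandwich[OF _ _ tendsto_const lim]) (use upper lower in auto)
  qed auto
qed

text \<open>The expected visits to \<open>N\<close> distinct points of \<open>I\<close> total at
  most \<open>n\<close>. All of these points have the same diagonal value, and the off-diagonal
  values agree with it up to o(n), so \<open>N\<close> times the averaged diagonal value is at most
  1 + o(1). Here \<open>N\<close> is arbitrary.\<close>

lemma green_null:
  assumes irr: "irreducible V p" and I: "infinite I" "I \<subseteq> V" "y \<in> I" and x: "x \<in> V"
    and hom: "\<And>y' n. y' \<in> I \<Longrightarrow> green V p n y' y' = green V p n y y"
  shows "(\<lambda>n. green V p n x y / n) \<longlonglongrightarrow> 0"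
proof -
  have y: "y \<in> V"
    using I by auto
  have diag: "(\<lambda>n. green V p n y y / n) \<longlonglongrightarrow> 0"
  proof (rule LIMSEQ_I)
    fix e :: real assume e: "e > 0"
    \<comment> \<open>The 2 pays for the total visit mass 1 and for an error \<open>?D n\<close>
      below 1.\<close>
    obtain N :: nat where N: "real N * e > 2"
      using e reals_Archimedean3 by blast
    obtain K where K: "K \<subseteq> I" "finite K" "card K = N"
      using infinite_arbitrarily_large[OF I(1)] by metis
    let ?D = "\<lambda>n. \<Sum>y'\<in>K. (green V p n y' y' - green V p n y y') / n"
    have "?D \<longlonglongrightarrow> (\<Sum>y'\<in>K. 0)"
      using K I y by (intro tendsto_sum green_diagonal_gap[OF irr]) auto
    hence "eventually (\<lambda>n. ?D n < 1) sequentially"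
      by (intro order_tendstoD(2)[where y = 0]) auto
    then obtain n0 where n0: "\<And>n. n \<ge> n0 \<Longrightarrow> ?D n < 1"
      by (auto simp: eventually_sequentially)
    have "norm (green V p n y y / n - 0) < e" if "n \<ge> n0" for n
    proof (cases "n = 0")
      case False
      have "(\<Sum>y'\<in>K. green V p n y y') \<le> n"
        using green_harmonic[OF harmonic_one, of y n] K I y green_bounds
        by (intro finite_sum_le_has_sum[where A = V]) auto
      hence "(\<Sum>y'\<in>K. green V p n y y' / n) \<le> 1"
        using False by (simp add: sum_divide_distrib[symmetric] field_simps)
      moreover have "?D n = N * (green V p n y y / n) - (\<Sum>y'\<in>K. green V p n y y' / n)"
        using K hom by (simp add: diff_divide_distrib sum_subtractf subset_iff)
      ultimately have "N * (green V p n y y / n) < N * e"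
        using n0[OF that] N by linarith
      thus ?thesis
        using green_bounds[OF y y, of n] N mult_less_cancel_left_pos[of "real N" "green V p n y y / n" e]
        by (cases "N = 0") (auto simp del: times_divide_eq_right)
    qed (use e in auto)
    thus "\<exists>n0. \<forall>n\<ge>n0. norm (green V p n y y / n - 0) < e"
      by blast
  qed
  show ?thesis
    by (rule tendsto_sandwich[OF _ _ tendsto_const diag])
      (use green_bounds[OF x y] green_le_diagonal[OF x y] in \<open>auto intro!: divide_right_mono always_eventually\<close>)
qed

section \<open>Averaged totals and the splitting of a harmonic function\<close>

text \<open>Domination by \<open>h\<close> gives summability and the linear bound in
  \<open>n\<close>. The last claim says that one more time step adds at most \<open>h x\<close>: the
  increment for \<open>f\<close> is dominated termwise by that for \<open>h\<close>, which equals
  \<open>Suc n * h x - n * h x\<close>.\<close>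

lemma green_average:
  assumes h: "harmonic V p h" and f: "\<And>y. y \<in> V \<Longrightarrow> 0 \<le> f y \<and> f y \<le> h y" and x: "x \<in> V"
  defines "U \<equiv> \<lambda>n x. infsum (\<lambda>y. green V p n x y * f y) V"
  shows "((\<lambda>y. green V p n x y * f y) has_sum U n x) V"
    and "0 \<le> U n x" and "U n x \<le> n * h x"
    and "((\<lambda>z. p x z * U n z) has_sum (U (Suc n) x - f x)) V"
    and "U (Suc n) x \<le> U n x + h x"
proof -
  have h_nonneg: "h z \<ge> 0" if "z \<in> V" for z
    using f[OF that] by linarith
  have green_h: "((\<lambda>y. green V p n z y * h y) has_sum (n * h z)) V" if "z \<in> V" for n z
    using green_harmonic[OF h h_nonneg that] .
  have U: "((\<lambda>y. green V p n z y * f y) has_sum U n z) V" if "z \<in> V" for n z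
    unfolding U_def
  proof (rule has_sum_infsum, rule summable_on_comparison_test)
    show "(\<lambda>y. green V p n z y * h y) summable_on V"
      using green_h[OF that] by (auto simp: summable_on_def)
  qed (use f green_bounds that in \<open>auto intro: mult_left_mono\<close>)
  have nonneg: "0 \<le> U n z" if "z \<in> V" for n z
    using f green_bounds that by (intro has_sum_nonneg[OF U]) auto
  have bound: "U n z \<le> n * h z" if "z \<in> V" for n z
    using f green_bounds that by (intro has_sum_mono[OF U green_h]) (auto intro: mult_left_mono)
  show "((\<lambda>y. green V p n x y * f y) has_sum U n x) V" "0 \<le> U n x" "U n x \<le> n * h x"
    using U nonneg bound x by auto
  have "(\<lambda>z. p x z * U n z) summable_on V"
  proof (rule summable_on_comparison_test)
    have "(\<lambda>z. n * (p x z * h z)) summable_on V"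
      using h x by (intro summable_on_cmult_right) (auto simp: harmonic_def summable_on_def)
    thus "(\<lambda>z. p x z * (n * h z)) summable_on V"
      by (simp add: mult.left_commute)
  qed (use nonneg bound p_nonneg x in \<open>auto intro!: mult_left_mono\<close>)
  then obtain s where s: "((\<lambda>z. p x z * U n z) has_sum s) V"
    by (auto simp: summable_on_def)
  have "U (Suc n) x = f x + s"
    using green_Suc_has_sum[OF x _ U s] f U[OF x, of "Suc n"] by (intro has_sum_unique) auto
  thus "((\<lambda>z. p x z * U n z) has_sum (U (Suc n) x - f x)) V"
    using s by simp
  have diff: "((\<lambda>y. (green V p (Suc n) x y - green V p n x y) * g y) has_sum (a - b)) V"
    if "((\<lambda>y. green V p (Suc n) x y * g y) has_sum a) V" "((\<lambda>y. green V p n x y * g y) has_sum b) V"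
    for g :: "'a \<Rightarrow> real" and a b
    using has_sum_add[OF that(1) has_sum_uminusI[OF that(2)]]
    by (simp add: left_diff_distrib)
  have "U (Suc n) x - U n x \<le> Suc n * h x - n * h x"
    using f x green_mono
    by (intro has_sum_mono[OF diff[OF U U] diff[OF green_h green_h]]) (auto intro!: mult_left_mono simp del: green.simps)
  thus "U (Suc n) x \<le> U n x + h x"
    by (simp add: algebra_simps)
qed

text \<open>A Fatou argument. Finite partial sums pass to the limit, and averaging
  \<open>?U n\<close> over one step exceeds it by at most \<open>h x\<close>, which disappears after
  division by \<open>k n\<close>. Only an inequality survives, since mass may escape to
  infinity.\<close>

lemma superharmonic_limit:
  assumes h: "harmonic V p h" and f: "\<And>y. y \<in> V \<Longrightarrow> 0 \<le> f y \<and> f y \<le> h y"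
    and k: "strict_mono (k :: nat \<Rightarrow> nat)"
    and lim: "\<And>x. x \<in> V \<Longrightarrow>
      (\<lambda>n. infsum (\<lambda>y. green V p (k n) x y * f y) V / k n) \<longlonglongrightarrow> u x"
    and x: "x \<in> V"
  shows "0 \<le> u x" and "(\<lambda>z. p x z * u z) summable_on V" and "infsum (\<lambda>z. p x z * u z) V \<le> u x"
proof -
  let ?U = "\<lambda>n x. infsum (\<lambda>y. green V p n x y * f y) V"
  have nonneg: "0 \<le> u z" if "z \<in> V" for z
    by (rule tendsto_lowerbound[OF lim[OF that]])
      (use green_average(2)[OF h f that] in auto)
  show "0 \<le> u x"
    using nonneg x .
  have finite: "(\<Sum>z\<in>F. p x z * u z) \<le> u x" if F: "finite F" "F \<subseteq> V" for F
  proof (rule tendsto_le[OF sequentially_bot])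
    show "(\<lambda>n. \<Sum>z\<in>F. p x z * (?U (k n) z / k n)) \<longlonglongrightarrow> (\<Sum>z\<in>F. p x z * u z)"
      using F by (intro tendsto_sum tendsto_mult tendsto_const lim) auto
    have "(\<lambda>n. h x / real (k n)) \<longlonglongrightarrow> 0"
      using LIMSEQ_subseq_LIMSEQ[OF lim_const_over_n k] by (simp add: o_def)
    from tendsto_add[OF lim[OF x] this]
    show "(\<lambda>n. ?U (k n) x / k n + h x / k n) \<longlonglongrightarrow> u x"
      by simp
    have "(\<Sum>z\<in>F. p x z * (?U (k n) z / k n)) \<le> ?U (k n) x / k n + h x / k n" for n
    proof -
      have "(\<Sum>z\<in>F. p x z * ?U (k n) z) \<le> ?U (Suc (k n)) x - f x"
        using green_average(4)[OF h f x] F green_average(2)[OF h f] p_nonneg x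
        by (intro finite_sum_le_has_sum[where A = V]) auto
      also have "\<dots> \<le> ?U (k n) x + h x"
        using green_average(5)[OF h f x, of "k n"] f[OF x] by linarith
      finally show ?thesis
        using divide_right_mono[of _ _ "real (k n)"]
        by (fastforce simp: sum_divide_distrib add_divide_distrib)
    qed
    thus "\<forall>\<^sub>F n in sequentially. (\<Sum>z\<in>F. p x z * (?U (k n) z / k n)) \<le> ?U (k n) x / k n + h x / k n"
      by simp
  qed
  show summable: "(\<lambda>z. p x z * u z) summable_on V"
    using finite nonneg p_nonneg x
    by (intro nonneg_bounded_partial_sums_imp_summable_on[where C = "u x"] eventually_finite_subsets_at_top_weakI) auto
  show "infsum (\<lambda>z. p x z * u z) V \<le> u x"
    using infsum_le_finite_sums[OF summable finite] by simp
qed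

text \<open>\<open>u\<close> and \<open>v\<close> are subsequential limits of the averaged totals of
  \<open>h\<close> restricted to \<open>A\<close> and to its complement. An automorphism moving only
  finitely many points of \<open>A\<close> changes the total over \<open>A\<close> by finitely many
  terms, each negligible by \<open>null\<close>.\<close>

lemma harmonic_split:
  assumes V: "countable V"
    and null: "\<And>x y. x \<in> V \<Longrightarrow> y \<in> V \<Longrightarrow> (\<lambda>n. green V p n x y / n) \<longlonglongrightarrow> 0"
    and h: "pos_harmonic V p h"
  obtains u v where "harmonic V p u" "harmonic V p v"
    and "\<And>x. x \<in> V \<Longrightarrow> 0 \<le> u x" "\<And>x. x \<in> V \<Longrightarrow> 0 \<le> v x" "\<And>x. x \<in> V \<Longrightarrow> h x = u x + v x"
    and "\<And>\<phi> x. \<lbrakk>chain_automorphism V p \<phi>; finite {y \<in> V \<inter> A. \<phi> y \<noteq> y}; x \<in> V\<rbrakk>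
      \<Longrightarrow> u (\<phi> x) = u x"
    and "\<And>\<phi> x. \<lbrakk>chain_automorphism V p \<phi>; finite {y \<in> V - A. \<phi> y \<noteq> y}; x \<in> V\<rbrakk>
      \<Longrightarrow> v (\<phi> x) = v x"
proof -
  have harm: "harmonic V p h" and pos: "\<And>x. x \<in> V \<Longrightarrow> h x > 0"
    using h by (auto simp: pos_harmonic_def)
  define f where "f B y = of_bool (y \<in> B) * h y" for B y
  have f: "0 \<le> f B y \<and> f B y \<le> h y" if "y \<in> V" for B y
    using pos[OF that] by (auto simp: f_def of_bool_def)
  define U where "U B n x = infsum (\<lambda>y. green V p n x y * f B y) V" for B n x
  have U: "((\<lambda>y. green V p n x y * f B y) has_sum U B n x) V" "0 \<le> U B n x" "U B n x \<le> n * h x"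
    if "x \<in> V" for B n x
    using green_average[OF harm f[of _ B] that, folded U_def] by auto
  have bounded: "norm (U A n x / (n * h x)) \<le> 1" if "x \<in> V" for n x
    using U(2,3)[OF that, of A n] pos[OF that] by (cases "n = 0") auto
  \<comment> \<open>Dividing by \<open>h x\<close> makes the bound 1 uniform in \<open>x\<close>, as
    pointwise subsequence extraction on a countable set requires.\<close>
  obtain k where k: "strict_mono (k :: nat \<Rightarrow> nat)"
    and "\<And>x. x \<in> V \<Longrightarrow> \<exists>l. (\<lambda>n. U A (k n) x / (k n * h x)) \<longlonglongrightarrow> l"
    using function_convergent_subsequence[OF V, of "\<lambda>n x. U A n x / (n * h x)" 1] bounded by metis
  then obtain l where l: "\<And>x. x \<in> V \<Longrightarrow> (\<lambda>n. U A (k n) x / (k n * h x)) \<longlonglongrightarrow> l x"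
    by metis
  define u where "u = (\<lambda>x. l x * h x)"
  define v where "v = (\<lambda>x. h x - u x)"
  have u: "(\<lambda>n. U A (k n) x / k n) \<longlonglongrightarrow> u x" if "x \<in> V" for x
    using tendsto_mult_right[OF l[OF that], of "h x"] pos[OF that] by (simp add: u_def)
  have compl: "U (-A) n x = n * h x - U A n x" if "x \<in> V" for n x
  proof -
    have "((\<lambda>y. green V p n x y * f A y + green V p n x y * f (-A) y) has_sum (U A n x + U (-A) n x)) V"
      using U(1)[OF that] by (intro has_sum_add)
    also have "(\<lambda>y. green V p n x y * f A y + green V p n x y * f (-A) y) = (\<lambda>y. green V p n x y * h y)"
      by (auto simp: f_def of_bool_def)
    finally show ?thesis
      using has_sum_unique[OF _ green_harmonic[OF harm _ that]] pos by (auto simp: less_imp_le)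
  qed
  have v: "(\<lambda>n. U (-A) (k n) x / k n) \<longlonglongrightarrow> v x" if "x \<in> V" for x
    unfolding v_def
  proof (rule Lim_transform_eventually[OF tendsto_diff[OF tendsto_const u[OF that]]])
    \<comment> \<open>At \<open>k n = 0\<close> division by zero returns 0 and the identity below
      would fail.\<close>
    have "eventually (\<lambda>n. k n > 0) sequentially"
      using eventually_compose_filterlim[OF eventually_gt_at_top filterlim_subseq[OF k]] .
    thus "eventually (\<lambda>n. h x - U A (k n) x / k n = U (-A) (k n) x / k n) sequentially"
      by eventually_elim (simp add: compl[OF that] diff_divide_distrib)
  qed
  have su: "0 \<le> u x" "(\<lambda>z. p x z * u z) summable_on V" "infsum (\<lambda>z. p x z * u z) V \<le> u x"
    if "x \<in> V" for x
    using superharmonic_limit[of h "f A" k u x] harm f k u that by (simp_all add: U_def)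
  have sv: "0 \<le> v x" "(\<lambda>z. p x z * v z) summable_on V" "infsum (\<lambda>z. p x z * v z) V \<le> v x"
    if "x \<in> V" for x
    using superharmonic_limit[of h "f (-A)" k v x] harm f k v that by (simp_all add: U_def)
  have uv: "((\<lambda>z. p x z * u z) has_sum u x) V \<and> ((\<lambda>z. p x z * v z) has_sum v x) V"
    if x: "x \<in> V" for x
  proof -
    have "infsum (\<lambda>z. p x z * u z) V + infsum (\<lambda>z. p x z * v z) V
        = infsum (\<lambda>z. p x z * u z + p x z * v z) V"
      using su(2) sv(2) x by (intro infsum_add[symmetric]) auto
    also have "(\<lambda>z. p x z * u z + p x z * v z) = (\<lambda>z. p x z * h z)"
      by (auto simp: v_def algebra_simps)
    also have "infsum (\<lambda>z. p x z * h z) V = u x + v x"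
      using harm x by (auto simp: harmonic_def v_def intro!: infsumI)
    \<comment> \<open>Both functions are superharmonic and their sum \<open>h\<close> is harmonic,
      so neither inequality can be strict.\<close>
    finally have "infsum (\<lambda>z. p x z * u z) V = u x \<and> infsum (\<lambda>z. p x z * v z) V = v x"
      using su(3)[OF x] sv(3)[OF x] by linarith
    thus ?thesis
      using has_sum_infsum[OF su(2)[OF x]] has_sum_infsum[OF sv(2)[OF x]] by simp
  qed
  have invariant: "w (\<phi> x) = w x"
    if w: "\<And>x. x \<in> V \<Longrightarrow> (\<lambda>n. U B (k n) x / k n) \<longlonglongrightarrow> w x"
      and \<phi>: "chain_automorphism V p \<phi>"
      and F: "finite {y \<in> V \<inter> B. \<phi> y \<noteq> y}" and x: "x \<in> V"
    for w B \<phi> x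
  proof -
    let ?F = "{y \<in> V \<inter> B. \<phi> y \<noteq> y}"
    have \<phi>x: "\<phi> x \<in> V"
      using \<phi> x by (auto simp: chain_automorphism_def bij_betw_def)
    \<comment> \<open>Where \<open>\<phi>\<close> fixes \<open>y\<close>,
      \<open>green_automorphism\<close> makes the two kernels equal; outside \<open>B\<close> the
      weight \<open>f B\<close> vanishes.\<close>
    have eq: "U B n (\<phi> x) - U B n x = (\<Sum>y\<in>?F. (green V p n (\<phi> x) y - green V p n x y) * f B y)" for n
    proof -
      have 1: "((\<lambda>y. green V p n (\<phi> x) y * f B y + - (green V p n x y * f B y)) has_sum
          (U B n (\<phi> x) + - U B n x)) V"
        using U(1)[OF x] U(1)[OF \<phi>x] by (intro has_sum_add has_sum_uminusI)
      have 2: "((\<lambda>y. green V p n (\<phi> x) y * f B y + - (green V p n x y * f B y)) has_sum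
          (\<Sum>y\<in>?F. (green V p n (\<phi> x) y - green V p n x y) * f B y)) V"
      proof (rule has_sum_finite_neutralI[OF F])
        fix y assume y: "y \<in> V - ?F"
        show "green V p n (\<phi> x) y * f B y + - (green V p n x y * f B y) = 0"
        proof (cases "y \<in> B")
          case True
          thus ?thesis
            using green_automorphism[OF \<phi> x, of y n] y by auto
        qed (simp add: f_def)
      qed (auto simp: left_diff_distrib)
      show ?thesis
        using has_sum_unique[OF 1 2] by simp
    qed
    have "(\<lambda>n. \<Sum>y\<in>?F. (green V p (k n) (\<phi> x) y / k n - green V p (k n) x y / k n) * f B y)
        \<longlonglongrightarrow> (\<Sum>y\<in>?F. (0 - 0) * f B y)"
      using LIMSEQ_subseq_LIMSEQ[OF null k] x \<phi>x
      by (intro tendsto_intros) (auto simp: o_def)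
    also have "(\<lambda>n. \<Sum>y\<in>?F. (green V p (k n) (\<phi> x) y / k n - green V p (k n) x y / k n) * f B y)
        = (\<lambda>n. U B (k n) (\<phi> x) / k n - U B (k n) x / k n)"
      by (simp add: diff_divide_distrib[symmetric] eq sum_divide_distrib)
    finally have "(\<lambda>n. U B (k n) (\<phi> x) / k n - U B (k n) x / k n) \<longlonglongrightarrow> 0"
      by simp
    from LIMSEQ_unique[OF this tendsto_diff[OF w[OF \<phi>x] w[OF x]]] show ?thesis
      by simp
  qed
  show thesis
  proof (rule that)
    show "harmonic V p u" "harmonic V p v"
      using uv by (auto simp: harmonic_def)
    show "0 \<le> u x" "0 \<le> v x" "h x = u x + v x" if "x \<in> V" for x
      using su(1) sv(1) that by (auto simp: v_def)
  qed (use invariant[OF u] invariant[OF v] in \<open>auto simp: Diff_eq\<close>)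
qed

text \<open>Minimum principle: a zero forces zeros at all points reachable by positive transitions,
  hence everywhere.\<close>

lemma nonneg_harmonic_zero_or_pos:
  assumes irr: "irreducible V p" and u: "harmonic V p u" "\<And>x. x \<in> V \<Longrightarrow> u x \<ge> 0"
  shows "(\<forall>x\<in>V. u x = 0) \<or> pos_harmonic V p u"
proof (rule disjCI)
  assume "\<not> pos_harmonic V p u"
  then obtain x where x: "x \<in> V" "u x = 0"
    using u by (force simp: pos_harmonic_def)
  have "u y = 0" if "y \<in> V" for y
  proof -
    have "(\<lambda>u v. u \<in> V \<and> v \<in> V \<and> p u v > 0)\<^sup>*\<^sup>* x y"
      using irr x that by (auto simp: irreducible_def)
    thus ?thesis
    proof induction
      case (step a b)
      have "(\<Sum>z\<in>{b}. p a z * u z) \<le> u a"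
        using u step p_nonneg
        by (intro finite_sum_le_has_sum[where A = V]) (auto simp: harmonic_def)
      thus ?case
        using step u(2)[of b] by (simp add: mult_le_0_iff)
    qed (use x in auto)
  qed
  thus "\<forall>x\<in>V. u x = 0" by auto
qed

end

subsection \<open>Trees and their automorphisms\<close>

text \<open>A vertex is coded by its level, a level below which its labels vanish, and the finite
  list of labels in between.\<close>

lemma countable_tree: "countable (tree s)"
proof (rule countable_subset)
  show "tree s \<subseteq> range (\<lambda>(n, m, l). (n, \<lambda>j. if m \<le> j \<and> j \<le> n then l ! nat (j - m) else 0))"
  proof
    fix x assume "x \<in> tree s"
    then obtain n a m where x: "x = (n, a)" "\<And>j. j > n \<Longrightarrow> a j = 0" "\<And>j. j < m \<Longrightarrow> a j = 0"
      by (auto simp: tree_def)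
    have "a = (\<lambda>j. if m \<le> j \<and> j \<le> n then map a [m..n] ! nat (j - m) else 0)"
      using x by (auto simp: fun_eq_iff nth_upto not_le)
    hence "x = (\<lambda>(n, m, l). (n, \<lambda>j. if m \<le> j \<and> j \<le> n then l ! nat (j - m) else 0)) (n, m, map a [m..n])"
      using x by simp
    thus "x \<in> range (\<lambda>(n, m, l). (n, \<lambda>j. if m \<le> j \<and> j \<le> n then l ! nat (j - m) else 0))"
      by blast
  qed
qed simp

text \<open>The strict descendants of the vertex at level m - 1 all of whose labels vanish; for m \<le> 1
  this vertex is an ancestor of the root.\<close>

definition root_cone :: "int \<Rightarrow> tv set" where
  "root_cone m = {x. m \<le> hor x \<and> (\<forall>j<m. snd x j = 0)}"

lemma root_cone_mono: "m' \<le> m \<Longrightarrow> root_cone m \<subseteq> root_cone m'"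
  by (auto simp: root_cone_def hor_def)

lemma tree_in_root_cone:
  assumes "x \<in> tree s"
  obtains m where "x \<in> root_cone m"
proof -
  obtain n a m where x: "x = (n, a)" "\<And>j. j < m \<Longrightarrow> a j = 0"
    using assms by (auto simp: tree_def)
  \<comment> \<open>The minimum is taken because the level \<open>n\<close> of \<open>x\<close> must
    also reach the index of the cone.\<close>
  hence "x \<in> root_cone (min n m)"
    by (auto simp: root_cone_def hor_def)
  thus ?thesis by (rule that)
qed

text \<open>Labels can be nonzero only at the levels from \<open>m\<close> to \<open>N\<close>,
  which leaves finitely many lists over \<open>s\<close> symbols.\<close>

lemma finite_root_cone_bounded: "finite {x \<in> tree s \<inter> root_cone m. hor x \<le> N}"
proof (rule finite_subset)
  let ?L = "{l. set l \<subseteq> {..<s} \<and> length l = nat (N - m + 1)}"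
  show "{x \<in> tree s \<inter> root_cone m. hor x \<le> N} \<subseteq>
    (\<lambda>(n, l). (n, \<lambda>j. if m \<le> j \<and> j \<le> N then l ! nat (j - m) else 0)) ` ({m..N} \<times> ?L)"
  proof
    fix x assume "x \<in> {x \<in> tree s \<inter> root_cone m. hor x \<le> N}"
    then obtain n a where x: "x = (n, a)" "m \<le> n" "n \<le> N" "\<And>j. a j < s"
      "\<And>j. j > n \<Longrightarrow> a j = 0" "\<And>j. j < m \<Longrightarrow> a j = 0"
      by (auto simp: tree_def root_cone_def hor_def)
    have "a = (\<lambda>j. if m \<le> j \<and> j \<le> N then map a [m..N] ! nat (j - m) else 0)"
      using x by (auto simp: fun_eq_iff nth_upto not_le)
    moreover have "map a [m..N] \<in> ?L"
      using x by auto
    ultimately show "x \<in> (\<lambda>(n, l). (n, \<lambda>j. if m \<le> j \<and> j \<le> N then l ! nat (j - m) else 0)) ` ({m..N} \<times> ?L)"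
      using x by (intro image_eqI[where x = "(n, map a [m..N])"]) auto
  qed
qed (use finite_lists_length_eq[of "{..<s}"] in auto)

lemma infinite_horocycle:
  assumes "s \<ge> 2"
  shows "infinite {x \<in> tree s. hor x = n}"
proof -
  \<comment> \<open>The only nonzero label is a 1 at level \<open>n - i\<close>; it is admissible
    because \<open>s\<close> is at least 2.\<close>
  let ?f = "\<lambda>i::nat. (n, \<lambda>j. of_bool (j = n - int i)) :: tv"
  have inj: "inj ?f"
    by (auto simp: inj_def fun_eq_iff of_bool_def split: if_splits)
  have sub: "range ?f \<subseteq> {x \<in> tree s. hor x = n}"
  proof clarify
    fix i :: nat
    show "?f i \<in> tree s \<and> hor (?f i) = n"
      using assms by (auto simp: tree_def hor_def intro!: exI[of _ "n - int i"])
  qed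
  show ?thesis
    using range_inj_infinite[OF inj] finite_subset[OF sub] by blast
qed

section \<open>Automorphisms and confluents\<close>

text \<open>Asking for involutions makes bijectivity automatic, with the map as its own inverse. The
  label exchanges used later are of this kind.\<close>

locale tree_automorphism =
  fixes s :: nat and g :: "tv \<Rightarrow> tv"
  assumes involution: "g (g x) = x"
    and pred_commute: "g (pred x) = pred (g x)"
    and hor_preserved: "hor (g x) = hor x"
    and tree_preserved: "x \<in> tree s \<Longrightarrow> g x \<in> tree s"
begin

lemma ancestors_image: "ancestors (g x) = g ` ancestors x"
proof -
  have "(pred ^^ k) (g x) = g ((pred ^^ k) x)" for k
    by (induction k) (auto simp: pred_commute)
  thus ?thesis
    by (auto simp: ancestors_def)
qed

end

lemma hor_pred_pow: "hor ((pred ^^ k) x) = hor x - int k"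
  by (induction k) (auto simp: pred_def hor_def)

lemma snd_pred_pow: "snd ((pred ^^ k) x) j = (if hor x - int k < j \<and> j \<le> hor x then 0 else snd x j)"
proof (induction k)
  case (Suc k)
  have "fst ((pred ^^ k) x) = hor x - int k"
    using hor_pred_pow[of k x] by (simp add: hor_def)
  moreover have "snd ((pred ^^ Suc k) x) j
      = (if j = fst ((pred ^^ k) x) then 0 else snd ((pred ^^ k) x) j)"
    by (simp add: pred_def[of "(pred ^^ k) x"])
  ultimately show ?case
    using Suc by auto
qed auto

lemma far_ancestor:
  assumes "x \<in> tree s"
  obtains m where "\<And>l. l < m \<Longrightarrow> (l, \<lambda>_. 0) \<in> ancestors x"
proof -
  obtain m where m: "\<And>j. j < m \<Longrightarrow> snd x j = 0"
    using assms by (fastforce simp: tree_def)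
  have zero: "snd x j = 0" if "hor x < j" for j
    using assms that by (auto simp: tree_def hor_def)
  show thesis
  proof (rule that[of "min m (hor x)"])
    fix l assume l: "l < min m (hor x)"
    have "fst ((pred ^^ nat (hor x - l)) x) = l"
      using l hor_pred_pow[of "nat (hor x - l)" x] by (simp add: hor_def)
    moreover have "snd ((pred ^^ nat (hor x - l)) x) = (\<lambda>_. 0)"
    proof
      fix j
      \<comment> \<open>The three ranges: labels of \<open>x\<close> that already vanish, labels
        erased by the predecessor steps, and labels above the level of \<open>x\<close>.\<close>
      consider "j \<le> l" | "l < j" "j \<le> hor x" | "hor x < j" by linarith
      thus "snd ((pred ^^ nat (hor x - l)) x) j = 0"
        using l m zero by cases (auto simp: snd_pred_pow)
    qed
    ultimately have "(pred ^^ nat (hor x - l)) x = (l, \<lambda>_. 0)"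
      by (auto simp: prod_eq_iff)
    thus "(l, \<lambda>_. 0) \<in> ancestors x"
      unfolding ancestors_def by (metis (mono_tags, lifting) mem_Collect_eq)
  qed
qed

lemma common_ancestor_exists:
  assumes "x \<in> tree s" "y \<in> tree s"
  shows "\<exists>z. z \<in> ancestors x \<and> z \<in> ancestors y"
proof -
  obtain m1 m2 where "\<And>l. l < m1 \<Longrightarrow> (l, \<lambda>_. 0) \<in> ancestors x"
    "\<And>l. l < m2 \<Longrightarrow> (l, \<lambda>_. 0) \<in> ancestors y"
    using assms far_ancestor by metis
  thus ?thesis
    by (metis lt_ex min_less_iff_conj)
qed

text \<open>\<open>confl\<close> is an \<open>ARG_MAX\<close> choice, so a maximiser must be
  exhibited. Levels drop by one per predecessor step, hence the first ancestor of \<open>x\<close>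
  that is also one of \<open>y\<close> is the highest.\<close>

lemma confl_exists:
  assumes "x \<in> tree s" "y \<in> tree s"
  shows "\<exists>z. z \<in> ancestors x \<and> z \<in> ancestors y \<and> 
    (\<forall>w. w \<in> ancestors x \<and> w \<in> ancestors y \<longrightarrow> hor w \<le> hor z)"
proof -
  let ?P = "\<lambda>k. (pred ^^ k) x \<in> ancestors y"
  have ex: "\<exists>k. ?P k"
    using common_ancestor_exists[OF assms] unfolding ancestors_def by blast
  let ?k = "LEAST k. ?P k"
  have "hor w \<le> hor ((pred ^^ ?k) x)" if "w \<in> ancestors x" "w \<in> ancestors y" for w
  proof -
    obtain k where k: "w = (pred ^^ k) x"
      using \<open>w \<in> ancestors x\<close> by (auto simp: ancestors_def)
    have "?k \<le> k"
      using that k by (intro Least_le) auto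
    thus ?thesis
      by (simp add: k hor_pred_pow)
  qed
  moreover have "(pred ^^ ?k) x \<in> ancestors x"
    by (auto simp: ancestors_def)
  ultimately show ?thesis
    using LeastI_ex[OF ex] by blast
qed

context tree_automorphism
begin

text \<open>Only the level of the confluent matters: \<open>g\<close> carries the common ancestors
  of \<open>x\<close> and \<open>y\<close> onto those of the images and keeps levels.\<close>

lemma up_preserved:
  assumes "x \<in> tree s" "y \<in> tree s"
  shows "up (g x) (g y) = up x y"
proof -
  obtain z where z: "z \<in> ancestors x" "z \<in> ancestors y"
    "\<And>w. w \<in> ancestors x \<Longrightarrow> w \<in> ancestors y \<Longrightarrow> hor w \<le> hor z"
    using confl_exists[OF assms] by blast
  have "hor (confl x y) = hor z"
    unfolding confl_def using z by (intro arg_max_equality) auto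
  moreover have "hor (confl (g x) (g y)) = hor (g z)"
    unfolding confl_def using z
    by (intro arg_max_equality) (auto simp: ancestors_image hor_preserved, metis involution)
  ultimately show ?thesis
    by (simp add: up_def hor_preserved)
qed

end

section \<open>Transitivity on horocycles\<close>

text \<open>Besides transitivity, the control on where \<open>g\<close> acts is essential: being the
  identity off one cone is what later leaves only finitely many relevant points moved.\<close>

lemma horocycle_swap:
  assumes x: "x \<in> tree s" "x \<in> root_cone m" and x': "x' \<in> tree s" "x' \<in> root_cone m" and hor: "hor x = hor x'"
  obtains g where "tree_automorphism s g" "g x = x'" "\<And>y. y \<notin> root_cone m \<Longrightarrow> g y = y"
proof -
  obtain n a b where ab: "x = (n, a)" "x' = (n, b)"
    using hor by (cases x, cases x') (auto simp: hor_def)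
  have zero: "a j = 0" "b j = 0" if "j < m \<or> j > n" for j
    using x x' ab that by (auto simp: tree_def root_cone_def hor_def)
  have less: "a j < s" "b j < s" for j
    using x x' ab by (auto simp: tree_def)
  \<comment> \<open>At each level exchange the labels of x and x', but only inside the cone: this keeps all other vertices fixed.\<close>
  define g :: "tv \<Rightarrow> tv" where "g y = (if y \<in> root_cone m
    then (fst y, \<lambda>j. if j \<le> fst y then Transposition.transpose (a j) (b j) (snd y j) else snd y j) else y)" for y
  \<comment> \<open>Below level \<open>m\<close> both \<open>a\<close> and \<open>b\<close> vanish,
    so the transpositions there are trivial.\<close>
  have cone_iff: "g y \<in> root_cone m \<longleftrightarrow> y \<in> root_cone m" for y
    using zero by (auto simp: g_def root_cone_def hor_def)
  show thesis
  proof (rule that)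
    show "tree_automorphism s g"
    proof
      fix y
      show "g (g y) = y"
      proof (cases "y \<in> root_cone m")
        case True
        thus ?thesis
          using cone_iff[of y] by (auto simp: g_def prod_eq_iff)
      qed (simp add: g_def)
      show "hor (g y) = hor y"
        by (simp add: g_def hor_def)
      show "g (pred y) = pred (g y)"
      \<comment> \<open>At level \<open>m\<close> the predecessor leaves the cone and is fixed;
        \<open>g\<close> can then alter only the label at level \<open>m\<close>, which
        \<open>pred\<close> erases.\<close>
      proof (cases "fst y = m")
        case True
        thus ?thesis
          using zero by (auto simp: g_def pred_def root_cone_def hor_def prod_eq_iff fun_eq_iff)
      next
        case False
        hence "pred y \<in> root_cone m \<longleftrightarrow> y \<in> root_cone m"
          by (auto simp: pred_def root_cone_def hor_def)
        thus ?thesis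
          by (auto simp: g_def pred_def prod_eq_iff fun_eq_iff)
      qed
      show "g y \<in> tree s" if y: "y \<in> tree s"
      proof (cases "y \<in> root_cone m")
        case True
        have "Transposition.transpose (a j) (b j) c < s" if "c < s" for c j
          using less[of j] that by (auto simp: Transposition.transpose_def)
        thus ?thesis
          using y True zero
          by (auto simp: g_def tree_def root_cone_def hor_def intro!: exI[of _ m])
      qed (use y in \<open>simp add: g_def\<close>)
    qed
    show "g x = x'"
      using x zero by (auto simp: g_def ab fun_eq_iff)
    show "g y = y" if "y \<notin> root_cone m" for y
      using that by (simp add: g_def)
  qed
qed

lemma horocycle_transitive:
  assumes "x \<in> tree s" "x' \<in> tree s" "hor x = hor x'"
  obtains g m where "tree_automorphism s g" "g x = x'" "\<And>y. y \<notin> root_cone m \<Longrightarrow> g y = y"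
proof -
  obtain m m' where "x \<in> root_cone m" "x' \<in> root_cone m'"
    using assms tree_in_root_cone by metis
  hence "x \<in> root_cone (min m m')" "x' \<in> root_cone (min m m')"
    using root_cone_mono[of "min m m'" m] root_cone_mono[of "min m m'" m'] by auto
  thus thesis
    using horocycle_swap assms that by metis
qed

lemma tree_automorphism_id: "tree_automorphism s id"
  by unfold_locales auto

subsection \<open>The horocyclic product\<close>

lemma mem_DL:
  "x \<in> DL q r \<longleftrightarrow> fst x \<in> tree q \<and> snd x \<in> tree r \<and> hor (fst x) + hor (snd x) = 0"
  by (cases x) (simp add: DL_def)

lemma bij_betw_DL:
  assumes "tree_automorphism q g1" "tree_automorphism r g2"
  shows "bij_betw (map_prod g1 g2) (DL q r) (DL q r)"
proof -
  interpret g1: tree_automorphism q g1 by fact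
  interpret g2: tree_automorphism r g2 by fact
  show ?thesis
    by (rule bij_betwI[where g = "map_prod g1 g2"])
      (simp_all add: mem_DL prod_eq_iff g1.involution g2.involution g1.hor_preserved
        g2.hor_preserved g1.tree_preserved g2.tree_preserved)
qed

lemma semi_isotropic_automorphism:
  assumes "semi_isotropic q r p" "tree_automorphism q g1" "tree_automorphism r g2"
    and "x \<in> DL q r" "y \<in> DL q r"
  shows "p (map_prod g1 g2 x) (map_prod g1 g2 y) = p x y"
proof -
  obtain m where m: "\<And>x y. x \<in> DL q r \<Longrightarrow> y \<in> DL q r \<Longrightarrow>
    p x y = m (up (fst x) (fst y), up (fst y) (fst x), up (snd x) (snd y), up (snd y) (snd x))"
    using assms(1) by (auto simp: semi_isotropic_def)
  have mem: "map_prod g1 g2 x \<in> DL q r" "map_prod g1 g2 y \<in> DL q r"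
    using bij_betwE[OF bij_betw_DL[OF assms(2,3)]] assms(4,5) by auto
  have trees: "fst x \<in> tree q" "fst y \<in> tree q" "snd x \<in> tree r" "snd y \<in> tree r"
    using assms(4,5) by (auto simp: DL_def)
  show ?thesis
    unfolding m[OF mem] m[OF assms(4,5)]
    using tree_automorphism.up_preserved[OF assms(2)] tree_automorphism.up_preserved[OF assms(3)] trees
    by simp
qed

lemma DL_second_exists:
  assumes "x \<in> tree q" "r \<ge> 1"
  shows "(x, - hor x, \<lambda>_. 0) \<in> DL q r"
  using assms by (auto simp: DL_def tree_def hor_def)

lemma DL_first_exists:
  assumes "x \<in> tree r" "q \<ge> 1"
  shows "((- hor x, \<lambda>_. 0), x) \<in> DL q r"
  using assms by (auto simp: DL_def tree_def hor_def)

lemma countable_DL: "countable (DL q r)"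
  by (rule countable_subset[of _ "tree q \<times> tree r"]) (auto simp: DL_def countable_tree)

text \<open>Each level is at least \<open>m\<close> and is the negative of the other, hence at most
  \<open>-m\<close>.\<close>

lemma finite_DL_root_cone: "finite {y \<in> DL q r. fst y \<in> root_cone m \<and> snd y \<in> root_cone m}"
proof (rule finite_subset)
  show "{y \<in> DL q r. fst y \<in> root_cone m \<and> snd y \<in> root_cone m} \<subseteq>
    {x \<in> tree q \<inter> root_cone m. hor x \<le> -m} \<times> {x \<in> tree r \<inter> root_cone m. hor x \<le> -m}"
    by (auto simp: DL_def root_cone_def)
qed (intro finite_cartesian_product finite_root_cone_bounded)

section \<open>Harmonic functions and the projections\<close>

text \<open>Frees the projection from its \<open>SOME\<close>: an automorphism of the second tree
  takes the chosen \<open>x2'\<close> to \<open>x2\<close> and permutes the fibre over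
  \<open>y1\<close>.\<close>

lemma proj1_eq:
  assumes p: "semi_isotropic q r p" and x: "(x1, x2) \<in> DL q r"
  shows "proj1 q r p x1 y1 = infsum (\<lambda>y2. p (x1, x2) (y1, y2)) {y2. (y1, y2) \<in> DL q r}"
proof -
  let ?D = "{y2. (y1, y2) \<in> DL q r}"
  define x2' where "x2' = (SOME x2. (x1, x2) \<in> DL q r)"
  have x': "(x1, x2') \<in> DL q r"
    unfolding x2'_def using x by (rule someI)
  obtain g where g: "tree_automorphism r g" "g x2' = x2"
    using x x' by (auto simp: DL_def intro: horocycle_transitive[of x2' r x2])
  interpret tree_automorphism r g by fact
  have "bij_betw g ?D ?D"
    by (rule bij_betwI[where g = g]) (auto simp: DL_def involution hor_preserved tree_preserved)
  from infsum_reindex_bij_betw[OF this, of "\<lambda>y2. p (x1, x2) (y1, y2)"]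
  have "infsum (\<lambda>y2. p (x1, x2) (y1, y2)) ?D = infsum (\<lambda>y2. p (x1, g x2') (y1, g y2)) ?D"
    by (simp add: g)
  also have "\<dots> = infsum (\<lambda>y2. p (x1, x2') (y1, y2)) ?D"
  proof (rule infsum_cong)
    fix y2 assume "y2 \<in> ?D"
    thus "p (x1, g x2') (y1, g y2) = p (x1, x2') (y1, y2)"
      using semi_isotropic_automorphism[OF p tree_automorphism_id g(1) x', of "(y1, y2)"] by simp
  qed
  finally show ?thesis
    by (simp add: proj1_def x2'_def)
qed

text \<open>Summation over the fibres of the first coordinate, on which \<open>f\<close> is
  constant. Non-negativity gives the joint summability needed to pass from the iterated sum to the
  sum over DL.\<close>

lemma harmonic_proj1_iff:
  assumes stoch: "stochastic (DL q r) p" and p: "semi_isotropic q r p" and r: "r \<ge> 1"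
    and f: "\<And>x. x \<in> tree q \<Longrightarrow> f x \<ge> 0"
  shows "harmonic (tree q) (proj1 q r p) f \<longleftrightarrow> harmonic (DL q r) p (f \<circ> fst)"
proof -
  let ?D = "\<lambda>y1. {y2. (y1, y2) \<in> DL q r}"
  have Sigma: "DL q r = Sigma (tree q) ?D"
    by (auto simp: DL_def)
  have iff: "((\<lambda>y1. proj1 q r p x1 y1 * f y1) has_sum s) (tree q)
      \<longleftrightarrow> ((\<lambda>y. p (x1, x2) y * f (fst y)) has_sum s) (DL q r)"
    if x: "(x1, x2) \<in> DL q r" for x1 x2 s
  proof -
    have nonneg: "p (x1, x2) y \<ge> 0" if "y \<in> DL q r" for y
      using stoch x that by (auto simp: stochastic_def)
    have "(\<lambda>(y1, y2). p (x1, x2) (y1, y2)) summable_on Sigma (tree q) ?D"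
      using stoch x unfolding Sigma[symmetric] by (auto simp: stochastic_def summable_on_def)
    from summable_on_SigmaD1[OF this]
    have inner: "((\<lambda>y2. p (x1, x2) (y1, y2) * f (fst (y1, y2))) has_sum (proj1 q r p x1 y1 * f y1)) (?D y1)"
      if "y1 \<in> tree q" for y1
      using that by (simp add: proj1_eq[OF p x] has_sum_cmult_left)
    show ?thesis
    proof
      assume *: "((\<lambda>y1. proj1 q r p x1 y1 * f y1) has_sum s) (tree q)"
      have "(\<lambda>y. p (x1, x2) y * f (fst y)) summable_on Sigma (tree q) ?D"
        using * f nonneg
        by (intro summable_on_SigmaI[OF inner]) (auto simp: summable_on_def)
      from has_sum_SigmaI[OF inner * this]
      show "((\<lambda>y. p (x1, x2) y * f (fst y)) has_sum s) (DL q r)"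
        by (simp add: Sigma[symmetric])
    next
      assume "((\<lambda>y. p (x1, x2) y * f (fst y)) has_sum s) (DL q r)"
      hence "((\<lambda>y. p (x1, x2) y * f (fst y)) has_sum s) (Sigma (tree q) ?D)"
        by (simp add: Sigma[symmetric])
      from has_sum_SigmaD[OF this inner]
      show "((\<lambda>y1. proj1 q r p x1 y1 * f y1) has_sum s) (tree q)"
        by simp
    qed
  qed
  show ?thesis
  proof
    assume "harmonic (tree q) (proj1 q r p) f"
    thus "harmonic (DL q r) p (f \<circ> fst)"
      using iff by (auto simp: harmonic_def DL_def)
  next
    assume harm: "harmonic (DL q r) p (f \<circ> fst)"
    show "harmonic (tree q) (proj1 q r p) f"
      unfolding harmonic_def
    proof
      \<comment> \<open>A single lift of \<open>x\<close> to DL suffices, since \<open>iff\<close>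
        holds for any second coordinate.\<close>
      fix x assume "x \<in> tree q"
      note x = DL_second_exists[OF this r]
      show "((\<lambda>y. proj1 q r p x y * f y) has_sum f x) (tree q)"
        using bspec[OF harm[unfolded harmonic_def] x] by (simp add: iff[OF x])
    qed
  qed
qed

lemma bij_betw_swap_DL: "bij_betw prod.swap (DL r q) (DL q r)"
  by (rule bij_betwI[where g = prod.swap]) (auto simp: DL_def)

text \<open>Exchanging the two trees turns this into the statement for the first projection; the
  exchanged kernel is semi-isotropic with the arguments of \<open>m\<close> permuted in
  pairs.\<close>

lemma harmonic_proj2_iff:
  assumes stoch: "stochastic (DL q r) p" and p: "semi_isotropic q r p" and q: "q \<ge> 1"
    and f: "\<And>x. x \<in> tree r \<Longrightarrow> f x \<ge> 0"
  shows "harmonic (tree r) (proj2 q r p) f \<longleftrightarrow> harmonic (DL q r) p (f \<circ> snd)"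
proof -
  define p' where "p' = (\<lambda>x y. p (prod.swap x) (prod.swap y))"
  have swap: "(x, y) \<in> DL r q \<longleftrightarrow> (y, x) \<in> DL q r" for x y
    by (auto simp: DL_def)
  have mem: "prod.swap x \<in> DL q r \<longleftrightarrow> x \<in> DL r q" for x
    by (cases x) (simp add: swap)
  have reindex: "((\<lambda>y. g (prod.swap y)) has_sum s) (DL r q) \<longleftrightarrow> (g has_sum s) (DL q r)" for g s
    by (rule has_sum_reindex_bij_betw[OF bij_betw_swap_DL])
  have "proj2 q r p = proj1 r q p'"
    by (simp add: fun_eq_iff proj1_def proj2_def p'_def swap)
  moreover have "stochastic (DL r q) p'"
    using stoch by (simp add: stochastic_def p'_def mem reindex del: split_paired_All)
  moreover have "semi_isotropic r q p'"
  proof -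
    obtain m where m: "\<And>x y. x \<in> DL q r \<Longrightarrow> y \<in> DL q r \<Longrightarrow>
      p x y = m (up (fst x) (fst y), up (fst y) (fst x), up (snd x) (snd y), up (snd y) (snd x))"
      using p by (auto simp: semi_isotropic_def)
    show ?thesis
      unfolding semi_isotropic_def p'_def
      by (rule exI[of _ "\<lambda>(a, b, c, d). m (c, d, a, b)"]) (auto simp: m swap)
  qed
  moreover have "harmonic (DL r q) p' (f \<circ> fst) \<longleftrightarrow> harmonic (DL q r) p (f \<circ> snd)"
  proof -
    have eq: "((\<lambda>y. p' x y * (f \<circ> fst) y) has_sum s) (DL r q)
        \<longleftrightarrow> ((\<lambda>y. p (prod.swap x) y * (f \<circ> snd) y) has_sum s) (DL q r)" for x s
      using reindex[of "\<lambda>y. p (prod.swap x) y * (f \<circ> snd) y" s] by (simp add: p'_def)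
    have ball: "(\<forall>x\<in>DL q r. Q x) \<longleftrightarrow> (\<forall>x\<in>DL r q. Q (prod.swap x))" for Q
      using mem by (metis swap_swap)
    show ?thesis
      unfolding harmonic_def eq
        ball[of "\<lambda>x. ((\<lambda>y. p x y * (f \<circ> snd) y) has_sum (f \<circ> snd) x) (DL q r)"]
      by simp
  qed
  ultimately show ?thesis
    using harmonic_proj1_iff[of r q p' f] q f by simp
qed

lemma harmonic_cong:
  assumes eq: "\<And>x. x \<in> V \<Longrightarrow> f x = g x"
  shows "harmonic V p f \<longleftrightarrow> harmonic V p g"
  unfolding harmonic_def
proof (rule ball_cong[OF refl])
  fix x assume "x \<in> V"
  thus "((\<lambda>y. p x y * f y) has_sum f x) V \<longleftrightarrow> ((\<lambda>y. p x y * g y) has_sum g x) V"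
    using has_sum_cong[of V "\<lambda>y. p x y * f y" "\<lambda>y. p x y * g y" "f x"] eq by simp
qed

text \<open>A competitor below \<open>k\<close> lifts to one below \<open>h\<close>, where
  minimality makes the ratio constant; surjectivity of \<open>\<pi>\<close> brings this back to
  \<open>W\<close>. Stated abstractly to serve both projections.\<close>

lemma minimal_harmonic_factor:
  assumes surj: "\<pi> ` V = W" and root: "o\<^sub>V \<in> V" "\<pi> o\<^sub>V = o\<^sub>W"
    and lift: "\<And>f. (\<And>x. x \<in> W \<Longrightarrow> f x \<ge> 0) \<Longrightarrow> harmonic W P f \<longleftrightarrow> harmonic V p (f \<circ> \<pi>)"
    and min: "minimal_harmonic V o\<^sub>V p h" and h: "\<And>x. x \<in> V \<Longrightarrow> h x = k (\<pi> x)"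
  shows "minimal_harmonic W o\<^sub>W P k"
proof -
  have pos_lift: "pos_harmonic W P f \<longleftrightarrow> pos_harmonic V p (f \<circ> \<pi>)" for f
  proof -
    have "(\<forall>x\<in>W. f x > 0) \<longleftrightarrow> (\<forall>x\<in>V. (f \<circ> \<pi>) x > 0)"
      using surj by auto
    thus ?thesis
      using lift[of f] by (auto simp: pos_harmonic_def less_imp_le)
  qed
  have "pos_harmonic V p (k \<circ> \<pi>)"
    using min h harmonic_cong[of V h "k \<circ> \<pi>" p] by (auto simp: minimal_harmonic_def pos_harmonic_def)
  moreover have "k o\<^sub>W = 1"
    using min h[OF root(1)] root(2) by (simp add: minimal_harmonic_def)
  moreover have "\<exists>c. \<forall>x\<in>W. f x = c * k x"
    if f: "pos_harmonic W P f" "\<forall>x\<in>W. f x \<le> k x" for f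
  proof -
    have "pos_harmonic V p (f \<circ> \<pi>)" "\<forall>x\<in>V. (f \<circ> \<pi>) x \<le> h x"
      using f pos_lift h surj by auto
    then obtain c where "\<forall>x\<in>V. (f \<circ> \<pi>) x = c * h x"
      using min unfolding minimal_harmonic_def by blast
    thus ?thesis
      using h surj by (intro exI[of _ c]) auto
  qed
  ultimately show ?thesis
    by (simp add: minimal_harmonic_def pos_lift)
qed

section \<open>Decomposition on the horocyclic product\<close>

lemma chain_automorphism_DL:
  assumes "semi_isotropic q r p" "tree_automorphism q g1" "tree_automorphism r g2"
  shows "chain_automorphism (DL q r) p (map_prod g1 g2)"
  using bij_betw_DL semi_isotropic_automorphism assms by (simp add: chain_automorphism_def)

text \<open>The fibre over \<open>y1\<close> is a copy of an infinite horocycle of the second tree.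
  Automorphisms acting on the second coordinate alone are transitive on it, so
  \<open>green_null\<close> applies.\<close>

lemma green_DL_null:
  assumes r: "r \<ge> 2" and stoch: "stochastic (DL q r) p" and irr: "irreducible (DL q r) p"
    and iso: "semi_isotropic q r p" and x: "x \<in> DL q r" and y: "y \<in> DL q r"
  shows "(\<lambda>n. green (DL q r) p n x y / n) \<longlonglongrightarrow> 0"
proof -
  interpret markov_chain "DL q r" p by (rule markov_chain.intro[OF stoch])
  obtain y1 y2 where y12: "y = (y1, y2)" "y1 \<in> tree q" "y2 \<in> tree r" "hor y2 = - hor y1"
    using y by (cases y) (auto simp: DL_def)
  let ?H = "{z \<in> tree r. hor z = - hor y1}"
  show ?thesis
  proof (rule green_null[OF irr _ _ _ x])
    show "infinite (Pair y1 ` ?H)"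
      using infinite_horocycle[OF r, of "- hor y1"] by (subst finite_image_iff) (auto simp: inj_on_def)
    show "Pair y1 ` ?H \<subseteq> DL q r" "y \<in> Pair y1 ` ?H"
      using y12 by (auto simp: mem_DL)
    fix y' n assume "y' \<in> Pair y1 ` ?H"
    then obtain z where z: "y' = (y1, z)" "z \<in> tree r" "hor y2 = hor z"
      using y12 by auto
    obtain g where g: "tree_automorphism r g" "g y2 = z"
      using horocycle_transitive[OF y12(3) z(2,3)] by metis
    show "green (DL q r) p n y' y' = green (DL q r) p n y y"
      using green_automorphism[OF chain_automorphism_DL[OF iso tree_automorphism_id g(1)] y y, of n] g(2) z(1) y12(1)
      by simp
  qed
qed

lemma pos_harmonic_DL_split:
  assumes q: "q \<ge> 2" and r: "r \<ge> 2" and stoch: "stochastic (DL q r) p"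
    and irr: "irreducible (DL q r) p" and iso: "semi_isotropic q r p" and h: "pos_harmonic (DL q r) p h"
  shows "\<exists>h1 h2. harmonic (tree q) (proj1 q r p) h1 \<and> (\<forall>x\<in>tree q. h1 x \<ge> 0)
    \<and> harmonic (tree r) (proj2 q r p) h2 \<and> (\<forall>x\<in>tree r. h2 x \<ge> 0)
    \<and> (\<forall>x\<in>DL q r. h x = h1 (fst x) + h2 (snd x))"
proof -
  interpret markov_chain "DL q r" p by (rule markov_chain.intro[OF stoch])
  \<comment> \<open>The two levels in a vertex of DL add up to 0, so only finitely many vertices have both coordinates
    in the cone of level m. In A the second coordinate being in that cone forces the first one to be,
    and outside A it is the other way round.\<close>
  define A where "A = {y :: dlv. \<forall>m. snd y \<in> root_cone m \<longrightarrow> fst y \<in> root_cone m}"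
  obtain u v where harm: "harmonic (DL q r) p u" "harmonic (DL q r) p v"
    and nonneg: "\<And>x. x \<in> DL q r \<Longrightarrow> 0 \<le> u x" "\<And>x. x \<in> DL q r \<Longrightarrow> 0 \<le> v x"
    and h_eq: "\<And>x. x \<in> DL q r \<Longrightarrow> h x = u x + v x"
    and u_inv: "\<And>\<phi> x. \<lbrakk>chain_automorphism (DL q r) p \<phi>; finite {y \<in> DL q r \<inter> A. \<phi> y \<noteq> y};
      x \<in> DL q r\<rbrakk> \<Longrightarrow> u (\<phi> x) = u x"
    and v_inv: "\<And>\<phi> x. \<lbrakk>chain_automorphism (DL q r) p \<phi>; finite {y \<in> DL q r - A. \<phi> y \<noteq> y};
      x \<in> DL q r\<rbrakk> \<Longrightarrow> v (\<phi> x) = v x"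
    using harmonic_split[OF countable_DL green_DL_null[OF r stoch irr iso] h, of A] by blast
  have u_const: "u (x1, x2) = u (x1, x2')" if "(x1, x2) \<in> DL q r" "(x1, x2') \<in> DL q r" for x1 x2 x2'
  proof -
    have "x2 \<in> tree r" "x2' \<in> tree r" "hor x2 = hor x2'"
      using that by (auto simp: DL_def)
    then obtain g m where g: "tree_automorphism r g" "g x2 = x2'" "\<And>y. y \<notin> root_cone m \<Longrightarrow> g y = y"
      by (blast elim: horocycle_transitive)
    \<comment> \<open>A moved point has its second coordinate in the cone, and membership in
      \<open>A\<close> then puts the first one there as well.\<close>
    have "{y \<in> DL q r \<inter> A. map_prod id g y \<noteq> y} \<subseteq> {y \<in> DL q r. fst y \<in> root_cone m \<and> snd y \<in> root_cone m}"
    proof safe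
      fix y1 y2 assume y: "(y1, y2) \<in> A" "map_prod id g (y1, y2) \<noteq> (y1, y2)"
      hence "y2 \<in> root_cone m"
        using g(3)[of y2] by fastforce
      thus "fst (y1, y2) \<in> root_cone m" "snd (y1, y2) \<in> root_cone m"
        using y by (auto simp: A_def)
    qed
    hence "finite {y \<in> DL q r \<inter> A. map_prod id g y \<noteq> y}"
      using finite_DL_root_cone by (rule finite_subset)
    from u_inv[OF chain_automorphism_DL[OF iso tree_automorphism_id g(1)] this that(1)]
    show ?thesis
      by (simp add: g)
  qed
  have v_const: "v (x1, x2) = v (x1', x2)" if "(x1, x2) \<in> DL q r" "(x1', x2) \<in> DL q r" for x1 x1' x2
  proof -
    have "x1 \<in> tree q" "x1' \<in> tree q" "hor x1 = hor x1'"
      using that by (auto simp: DL_def)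
    then obtain g m where g: "tree_automorphism q g" "g x1 = x1'" "\<And>y. y \<notin> root_cone m \<Longrightarrow> g y = y"
      by (blast elim: horocycle_transitive)
    have "{y \<in> DL q r - A. map_prod g id y \<noteq> y} \<subseteq> {y \<in> DL q r. fst y \<in> root_cone m \<and> snd y \<in> root_cone m}"
    proof safe
      fix y1 y2 assume y: "(y1, y2) \<notin> A" "map_prod g id (y1, y2) \<noteq> (y1, y2)"
      have y1: "y1 \<in> root_cone m"
        using y(2) g(3)[of y1] by fastforce
      obtain k where k: "y2 \<in> root_cone k" "y1 \<notin> root_cone k"
        using y(1) by (auto simp: A_def)
      \<comment> \<open>Cones are nested: \<open>y1\<close> lies in the cone of \<open>m\<close> but
        not in that of \<open>k\<close>, so the latter is the smaller one.\<close>
      have "m \<le> k"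
        using y1 k(2) root_cone_mono[of k m] by force
      hence "y2 \<in> root_cone m"
        using k(1) root_cone_mono by blast
      thus "fst (y1, y2) \<in> root_cone m" "snd (y1, y2) \<in> root_cone m"
        using y1 by auto
    qed
    hence "finite {y \<in> DL q r - A. map_prod g id y \<noteq> y}"
      using finite_DL_root_cone by (rule finite_subset)
    from v_inv[OF chain_automorphism_DL[OF iso g(1) tree_automorphism_id] this that(1)]
    show ?thesis
      by (simp add: g)
  qed
  \<comment> \<open>By \<open>u_const\<close> any lift of \<open>x\<close> would do; the one with
    vanishing second labels is an explicit choice.\<close>
  define h1 :: "tv \<Rightarrow> real" where "h1 x = u (x, - hor x, \<lambda>_. 0)" for x
  define h2 :: "tv \<Rightarrow> real" where "h2 x = v ((- hor x, \<lambda>_. 0), x)" for x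
  have q1: "q \<ge> 1" and r1: "r \<ge> 1"
    using q r by auto
  have u_eq: "u x = (h1 \<circ> fst) x" if x: "x \<in> DL q r" for x
  proof (cases x rule: prod.exhaust)
    case (Pair x1 x2)
    have "(x1, - hor x1, \<lambda>_. 0) \<in> DL q r"
      using x Pair r1 by (intro DL_second_exists) (auto simp: mem_DL)
    thus ?thesis
      using u_const[of x1 x2 "(- hor x1, \<lambda>_. 0)"] x Pair by (simp add: h1_def)
  qed
  have v_eq: "v x = (h2 \<circ> snd) x" if x: "x \<in> DL q r" for x
  proof (cases x rule: prod.exhaust)
    case (Pair x1 x2)
    have "((- hor x2, \<lambda>_. 0), x2) \<in> DL q r"
      using x Pair q1 by (intro DL_first_exists) (auto simp: mem_DL)
    thus ?thesis
      using v_const[of x1 x2 "(- hor x2, \<lambda>_. 0)"] x Pair by (simp add: h2_def)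
  qed
  have h1_nonneg: "h1 x \<ge> 0" if "x \<in> tree q" for x
    using nonneg(1)[OF DL_second_exists[OF that r1]] by (simp add: h1_def)
  have h2_nonneg: "h2 x \<ge> 0" if "x \<in> tree r" for x
    using nonneg(2)[OF DL_first_exists[OF that q1]] by (simp add: h2_def)
  show ?thesis
  proof (intro exI conjI ballI)
    show "harmonic (tree q) (proj1 q r p) h1"
      using harm(1) harmonic_cong[of "DL q r" u "h1 \<circ> fst" p, OF u_eq]
      by (subst harmonic_proj1_iff[OF stoch iso r1 h1_nonneg]) auto
    show "harmonic (tree r) (proj2 q r p) h2"
      using harm(2) harmonic_cong[of "DL q r" v "h2 \<circ> snd" p, OF v_eq]
      by (subst harmonic_proj2_iff[OF stoch iso q1 h2_nonneg]) auto
    show "h x = h1 (fst x) + h2 (snd x)" if "x \<in> DL q r" for x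
      using h_eq u_eq v_eq that by simp
  qed (use h1_nonneg h2_nonneg in auto)
qed

theorem theorem3p3:
  fixes q r :: nat and p :: "dlv \<Rightarrow> dlv \<Rightarrow> real"
  assumes "q \<ge> 2" and "r \<ge> 2"
    and "stochastic (DL q r) p"
    and "irreducible (DL q r) p"
    and "semi_isotropic q r p"
  shows "(\<forall>h. minimal_harmonic (DL q r) DL_root p h \<longrightarrow>
            (\<exists>h1. minimal_harmonic (tree q) troot (proj1 q r p) h1 \<and> (\<forall>x\<in>DL q r. h x = h1 (fst x)))
          \<or> (\<exists>h2. minimal_harmonic (tree r) troot (proj2 q r p) h2 \<and> (\<forall>x\<in>DL q r. h x = h2 (snd x))))
       \<and> (\<forall>h. pos_harmonic (DL q r) p h \<longrightarrow>
            (\<exists>h1 h2. harmonic (tree q) (proj1 q r p) h1 \<and> (\<forall>x\<in>tree q. h1 x \<ge> 0)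
                   \<and> harmonic (tree r) (proj2 q r p) h2 \<and> (\<forall>x\<in>tree r. h2 x \<ge> 0)
                   \<and> (\<forall>x\<in>DL q r. h x = h1 (fst x) + h2 (snd x))))"
proof (intro conjI allI impI)
  interpret markov_chain "DL q r" p by (rule markov_chain.intro[OF assms(3)])
  have q1: "q \<ge> 1" and r1: "r \<ge> 1"
    using assms by auto
  have root: "DL_root \<in> DL q r" "fst DL_root = troot" "snd DL_root = troot"
    using q1 r1 by (auto simp: DL_root_def troot_def DL_def tree_def hor_def)
  have fst_surj: "fst ` DL q r = tree q"
  proof
    show "tree q \<subseteq> fst ` DL q r"
      using DL_second_exists[OF _ r1] by force
  qed (auto simp: mem_DL)
  have snd_surj: "snd ` DL q r = tree r"
  proof
    show "tree r \<subseteq> snd ` DL q r"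
      using DL_first_exists[OF _ q1] by force
  qed (auto simp: mem_DL)
  note lift1 = harmonic_proj1_iff[OF assms(3,5) r1]
  note lift2 = harmonic_proj2_iff[OF assms(3,5) q1]
  {
    fix h assume min: "minimal_harmonic (DL q r) DL_root p h"
    hence pos: "pos_harmonic (DL q r) p h"
      by (simp add: minimal_harmonic_def)
    obtain h1 h2 where h1: "harmonic (tree q) (proj1 q r p) h1" "\<And>x. x \<in> tree q \<Longrightarrow> h1 x \<ge> 0"
      and h2: "harmonic (tree r) (proj2 q r p) h2" "\<And>x. x \<in> tree r \<Longrightarrow> h2 x \<ge> 0"
      and h_eq: "\<And>x. x \<in> DL q r \<Longrightarrow> h x = h1 (fst x) + h2 (snd x)"
      using pos_harmonic_DL_split[OF assms pos] by blast
    have harm1: "harmonic (DL q r) p (h1 \<circ> fst)"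
      using lift1[of h1] h1 by simp
    have nonneg1: "(h1 \<circ> fst) x \<ge> 0" and nonneg2: "h2 (snd x) \<ge> 0" if "x \<in> DL q r" for x
      using h1(2) h2(2) that by (auto simp: mem_DL)
    from nonneg_harmonic_zero_or_pos[OF assms(4) harm1 nonneg1]
    show "(\<exists>h1. minimal_harmonic (tree q) troot (proj1 q r p) h1 \<and> (\<forall>x\<in>DL q r. h x = h1 (fst x)))
      \<or> (\<exists>h2. minimal_harmonic (tree r) troot (proj2 q r p) h2 \<and> (\<forall>x\<in>DL q r. h x = h2 (snd x)))"
    proof
      assume "\<forall>x\<in>DL q r. (h1 \<circ> fst) x = 0"
      hence eq: "h x = h2 (snd x)" if "x \<in> DL q r" for x
        using h_eq[OF that] that by auto
      have "minimal_harmonic (tree r) troot (proj2 q r p) h2"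
        by (rule minimal_harmonic_factor[OF snd_surj root(1,3) lift2 min eq])
      thus ?thesis
        using eq by blast
    next
      assume pos1: "pos_harmonic (DL q r) p (h1 \<circ> fst)"
      moreover have "\<forall>x\<in>DL q r. (h1 \<circ> fst) x \<le> h x"
        using h_eq nonneg2 by simp
      ultimately obtain c where c: "\<And>x. x \<in> DL q r \<Longrightarrow> (h1 \<circ> fst) x = c * h x"
        using min unfolding minimal_harmonic_def by blast
      \<comment> \<open>At the root the left-hand side is positive. Dividing by \<open>c\<close>
        below also restores the value 1 at the root.\<close>
      have "c \<noteq> 0"
        using c[OF root(1)] pos1 root(1) by (auto simp: pos_harmonic_def)
      hence eq: "h x = h1 (fst x) / c" if "x \<in> DL q r" for x
        using c[OF that] by simp
      have "minimal_harmonic (tree q) troot (proj1 q r p) (\<lambda>x. h1 x / c)"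
        by (rule minimal_harmonic_factor[OF fst_surj root(1,2) lift1 min eq])
      thus ?thesis
        using eq by blast
    qed
  }
  show "\<exists>h1 h2. harmonic (tree q) (proj1 q r p) h1 \<and> (\<forall>x\<in>tree q. h1 x \<ge> 0)
      \<and> harmonic (tree r) (proj2 q r p) h2 \<and> (\<forall>x\<in>tree r. h2 x \<ge> 0)
      \<and> (\<forall>x\<in>DL q r. h x = h1 (fst x) + h2 (snd x))"
    if "pos_harmonic (DL q r) p h" for h
    using pos_harmonic_DL_split[OF assms that] .
qed

end
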